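(* Suppose $\frac{\delta}{\mu}<\beta\le\frac{2\delta}{\mu}$ and $M>M_0(\beta)$. Then the function $$V(x)=\begin{cases}K\left(e^{r_+(\beta)x}-e^{r_-(\beta)x}\right), & 0\le x<x_1,\\[1mm] \dfrac{M}{\gamma}+\dfrac{1}{\tilde r_-(\beta)}e^{\tilde r_-(\beta)(x-x_1)}, & x\ge x_1,\end{cases}$$ (with all quantities as defined in the context) is a concave, twice continuously differentiable solution on $[0,\infty)$ of the HJB equation $$0=\max_{\alpha\le a\le\beta}\left(\tfrac12\sigma^2a^2V''(x)+(a\mu-\delta)V'(x)-\gamma V(x)+M(1-V'(x))^+\right),\qquad V(0)=0,$$ and it satisfies $0\le V(x)\le\frac{M}{\gamma}$ for all $x>0$.
   Context: Parameters: real constants $\mu>0$, $\sigma>0$, $\gamma>0$, $\delta\ge0$, $M>0$, $0<\alpha<\beta<\infty$; $y^+=\max(y,0)$. $r_\pm(\beta)=\dfrac{-(\beta\mu-\delta)\pm\sqrt{(\beta\mu-\delta)^2+2\gamma\sigma^2\beta^2}}{\sigma^2\beta^2}$, $\quad\tilde r_-(\beta)=\dfrac{-(\beta\mu-\delta-M)-\sqrt{(\beta\mu-\delta-M)^2+2\gamma\sigma^2\beta^2}}{\sigma^2\beta^2}$. $M_0(\beta)=\dfrac{\sigma^2\beta^2\gamma}{2(\beta\mu-\delta)}$. $x_1=\dfrac{1}{r_+(\beta)-r_-(\beta)}\log\left(\dfrac{r_-(\beta)(r_-(\beta)-\tilde r_-(\beta))}{r_+(\beta)(r_+(\beta)-\tilde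 r_-(\beta))}\right)$. $K$ is determined by $K\left(r_+(\beta)e^{r_+(\beta)x_1}-r_-(\beta)e^{r_-(\beta)x_1}\right)=1$. *)

theory Defs
  imports "HOL-Analysis.Analysis"
begin

definition r_plus :: "real \<Rightarrow> real \<Rightarrow> real \<Rightarrow> real \<Rightarrow> real \<Rightarrow> real" where
  "r_plus \<mu> \<sigma> \<gamma> \<delta> \<beta> =
     (- (\<beta> * \<mu> - \<delta>) + sqrt ((\<beta> * \<mu> - \<delta>)\<^sup>2 + 2 * \<gamma> * \<sigma>\<^sup>2 * \<beta>\<^sup>2)) / (\<sigma>\<^sup>2 * \<beta>\<^sup>2)"

definition r_minus :: "real \<Rightarrow> real \<Rightarrow> real \<Rightarrow> real \<Rightarrow> real \<Rightarrow> real" where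
  "r_minus \<mu> \<sigma> \<gamma> \<delta> \<beta> =
     (- (\<beta> * \<mu> - \<delta>) - sqrt ((\<beta> * \<mu> - \<delta>)\<^sup>2 + 2 * \<gamma> * \<sigma>\<^sup>2 * \<beta>\<^sup>2)) / (\<sigma>\<^sup>2 * \<beta>\<^sup>2)"

definition rt_minus :: "real \<Rightarrow> real \<Rightarrow> real \<Rightarrow> real \<Rightarrow> real \<Rightarrow> real \<Rightarrow> real" where
  "rt_minus \<mu> \<sigma> \<gamma> \<delta> M \<beta> =
     (- (\<beta> * \<mu> - \<delta> - M) - sqrt ((\<beta> * \<mu> - \<delta> - M)\<^sup>2 + 2 * \<gamma> * \<sigma>\<^sup>2 * \<beta>\<^sup>2)) / (\<sigma>\<^sup>2 * \<beta>\<^sup>2)"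

definition M0 :: "real \<Rightarrow> real \<Rightarrow> real \<Rightarrow> real \<Rightarrow> real \<Rightarrow> real" where
  "M0 \<mu> \<sigma> \<gamma> \<delta> \<beta> = \<sigma>\<^sup>2 * \<beta>\<^sup>2 * \<gamma> / (2 * (\<beta> * \<mu> - \<delta>))"

definition x1 :: "real \<Rightarrow> real \<Rightarrow> real \<Rightarrow> real \<Rightarrow> real \<Rightarrow> real \<Rightarrow> real" where
  "x1 \<mu> \<sigma> \<gamma> \<delta> M \<beta> =
     (let rp = r_plus \<mu> \<sigma> \<gamma> \<delta> \<beta>; rm = r_minus \<mu> \<sigma> \<gamma> \<delta> \<beta>; rt = rt_minus \<mu> \<sigma> \<gamma> \<delta> M \<beta>
      in 1 / (rp - rm) * ln ((rm * (rm - rt)) / (rp * (rp - rt))))"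

definition K_const :: "real \<Rightarrow> real \<Rightarrow> real \<Rightarrow> real \<Rightarrow> real \<Rightarrow> real \<Rightarrow> real" where
  "K_const \<mu> \<sigma> \<gamma> \<delta> M \<beta> =
     (let rp = r_plus \<mu> \<sigma> \<gamma> \<delta> \<beta>; rm = r_minus \<mu> \<sigma> \<gamma> \<delta> \<beta>; z = x1 \<mu> \<sigma> \<gamma> \<delta> M \<beta>
      in THE K. K * (rp * exp (rp * z) - rm * exp (rm * z)) = 1)"

text \<open>Only the values of V on \<open>{0..}\<close> matter; the first formula also fixes the irrelevant
  values at negative arguments.\<close>

definition V :: "real \<Rightarrow> real \<Rightarrow> real \<Rightarrow> real \<Rightarrow> real \<Rightarrow> real \<Rightarrow> real \<Rightarrow> real" where
  "V \<mu> \<sigma> \<gamma> \<delta> M \<beta> x =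
     (let rp = r_plus \<mu> \<sigma> \<gamma> \<delta> \<beta>; rm = r_minus \<mu> \<sigma> \<gamma> \<delta> \<beta>; rt = rt_minus \<mu> \<sigma> \<gamma> \<delta> M \<beta>;
          z = x1 \<mu> \<sigma> \<gamma> \<delta> M \<beta>; K = K_const \<mu> \<sigma> \<gamma> \<delta> M \<beta>
      in if x < z then K * (exp (rp * x) - exp (rm * x))
         else M / \<gamma> + 1 / rt * exp (rt * (x - z)))"

text \<open>\<open>f\<close> is twice continuously differentiable on \<open>S\<close> with derivatives \<open>f'\<close> and \<open>f''\<close>;
  on \<open>{0..}\<close> the derivatives at the endpoint are one-sided, and \<open>f'\<close>, \<open>f''\<close> are uniquely
  determined there.\<close>

definition C2_on_with ::
  "real set \<Rightarrow> (real \<Rightarrow> real) \<Rightarrow> (real \<Rightarrow> real) \<Rightarrow> (real \<Rightarrow> real) \<Rightarrow> bool" where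
  "C2_on_with S f f' f'' \<longleftrightarrow>
     (\<forall>x\<in>S. (f has_real_derivative f' x) (at x within S)) \<and>
     (\<forall>x\<in>S. (f' has_real_derivative f'' x) (at x within S)) \<and>
     continuous_on S f''"

definition is_max_over :: "real \<Rightarrow> (real \<Rightarrow> real) \<Rightarrow> real set \<Rightarrow> bool" where
  "is_max_over m f A \<longleftrightarrow> m \<in> f ` A \<and> (\<forall>a\<in>A. f a \<le> m)"

definition solves_HJB ::
  "real \<Rightarrow> real \<Rightarrow> real \<Rightarrow> real \<Rightarrow> real \<Rightarrow> real \<Rightarrow> real \<Rightarrow>
   (real \<Rightarrow> real) \<Rightarrow> (real \<Rightarrow> real) \<Rightarrow> (real \<Rightarrow> real) \<Rightarrow> bool" where
  "solves_HJB \<mu> \<sigma> \<gamma> \<delta> M \<alpha> \<beta> v v' v'' \<longleftrightarrow>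
     (\<forall>x\<ge>0. is_max_over 0
        (\<lambda>a. 1 / 2 * \<sigma>\<^sup>2 * a\<^sup>2 * v'' x + (a * \<mu> - \<delta>) * v' x - \<gamma> * v x + M * max (1 - v' x) 0)
        {\<alpha>..\<beta>}) \<and>
     v 0 = 0"

end

theory Submission
  imports Defs
begin

text \<open>
  Write \<open>s = \<sigma>\<^sup>2 \<beta>\<^sup>2\<close> and \<open>b = \<beta> \<mu> - \<delta> > 0\<close>, and let \<open>p > 0 > m\<close> and \<open>t < 0\<close> be the numbers
  \<open>r_plus\<close>, \<open>r_minus\<close> and \<open>rt_minus\<close>.  With the control fixed at \<open>a = \<beta>\<close>, the HJB equation is a linear
  equation with constant coefficients on each side of the level where \<open>V' = 1\<close>; the characteristic
  roots are \<open>p, m\<close> where \<open>V' \<ge> 1\<close>, and \<open>t\<close> is the decaying one where \<open>V' \<le> 1\<close>.  The function \<open>V\<close>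
  pastes a solution of each equation at \<open>x\<^sub>1\<close>.  The constant \<open>K\<close> makes both slopes equal to \<open>1\<close>
  there, and \<open>x\<^sub>1\<close> is the point where the left branch has \<open>V''/V' = t\<close>, so the second derivatives
  match as well; the two differential equations then force the values to match
  (lemma \<open>value_fit\<close>).

  The left branch has increasing second derivative, and this equals \<open>t < 0\<close> at \<open>x\<^sub>1\<close>; hence \<open>V\<close> is
  concave.  So \<open>V'\<close> decreases through the value \<open>1\<close> exactly at \<open>x\<^sub>1\<close>, and \<open>V\<close> satisfies the equation
  with \<open>a = \<beta>\<close> including the nonlinear term \<open>M (1 - V')\<^sup>+\<close> (lemma \<open>ode\<close>).

  The remaining point is that \<open>a = \<beta>\<close> is optimal.  The Hamiltonian is concave in \<open>a\<close> since \<open>V'' < 0\<close>,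
  so it suffices that its derivative \<open>\<sigma>\<^sup>2 \<beta> V'' + \<mu> V'\<close> at \<open>a = \<beta>\<close> is nonnegative.  The bound
  \<open>s V'' + 2 b V' \<ge> 0\<close> (lemma \<open>drift_dominates\<close>) gives this because \<open>2 b \<le> \<beta> \<mu>\<close>, which is the
  hypothesis \<open>\<beta> \<le> 2 \<delta> / \<mu>\<close>.  To the left of \<open>x\<^sub>1\<close> the bound says that \<open>2 \<gamma> V \<ge> 0\<close>; to the right it
  says that \<open>t \<ge> - 2 b / s = p + m\<close>.

  The same comparison of \<open>t\<close> with \<open>p + m\<close> decides whether \<open>x\<^sub>1\<close> is positive, and it is where
  \<open>M > M\<^sub>0(\<beta>)\<close> enters: the characteristic polynomial of \<open>t\<close>, evaluated at \<open>- 2 b / s\<close>, is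
  \<open>2 b M / s - \<gamma>\<close>, and it is positive on the negative axis precisely to the left of \<open>t\<close>.
\<close>

section \<open>Pasting differentiable functions\<close>

lemma has_real_derivative_glue:
  fixes f g f' g' :: "real \<Rightarrow> real"
  assumes f: "\<And>x. (f has_real_derivative f' x) (at x)"
    and g: "\<And>x. (g has_real_derivative g' x) (at x)"
    and val: "f z = g z" and slope: "f' z = g' z"
  shows "((\<lambda>x. if x < z then f x else g x) has_real_derivative (if x < z then f' x else g' x)) (at x)"
proof -
  have "((\<lambda>x. if x \<in> {..<z} then f x else g x) has_vector_derivative
          (if x \<in> {..<z} then f' x else g' x)) (at x within UNIV)"
    using f g val slope
    by (intro has_vector_derivative_If_within_closures[where T = "{z..}"])
       (auto simp: has_real_derivative_iff_has_vector_derivative[symmetric]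
          intro: DERIV_subset)
  then show ?thesis
    by (simp add: has_real_derivative_iff_has_vector_derivative)
qed

section \<open>Characteristic roots\<close>

lemma quadratic_roots:
  fixes s b \<gamma> :: real
  assumes "s > 0" and "\<gamma> > 0"
  defines "p \<equiv> (- b + sqrt (b\<^sup>2 + 2 * \<gamma> * s)) / s"
    and "m \<equiv> (- b - sqrt (b\<^sup>2 + 2 * \<gamma> * s)) / s"
  shows "p > 0" and "m < 0" and "s * (p + m) = - 2 * b"
    and "s / 2 * p\<^sup>2 + b * p = \<gamma>" and "s / 2 * m\<^sup>2 + b * m = \<gamma>"
proof -
  define D where "D = sqrt (b\<^sup>2 + 2 * \<gamma> * s)"
  have sq: "D\<^sup>2 = b\<^sup>2 + 2 * \<gamma> * s"
    using assms(1,2) by (simp add: D_def)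
  have "sqrt (b\<^sup>2) < D"
    unfolding D_def using assms(1,2) by (intro real_sqrt_less_mono) simp
  then have D: "\<bar>b\<bar> < D" by simp
  have p: "s * p = - b + D" and m: "s * m = - b - D"
    using assms(1) by (simp_all add: p_def m_def D_def)
  have "0 < s * p" and "s * m < 0"
    using p m D by linarith+
  then show "p > 0" and "m < 0"
    using assms(1) by (simp_all add: zero_less_mult_iff mult_less_0_iff)
  show "s * (p + m) = - 2 * b"
    using p m by (simp add: algebra_simps)
  have "(s * p + b)\<^sup>2 = D\<^sup>2" and "(s * m + b)\<^sup>2 = D\<^sup>2"
    by (simp_all add: p m)
  then have "s * (s / 2 * p\<^sup>2 + b * p) = s * \<gamma>" and "s * (s / 2 * m\<^sup>2 + b * m) = s * \<gamma>"
    unfolding sq by (simp_all add: power2_eq_square field_simps)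
  then show "s / 2 * p\<^sup>2 + b * p = \<gamma>" and "s / 2 * m\<^sup>2 + b * m = \<gamma>"
    using assms(1) by simp_all
qed

text \<open>
  For \<open>x < 0\<close>, dividing by \<open>x\<close> turns positivity of the polynomial into \<open>s x / 2 + c < \<gamma> / x\<close>.  The left
  side increases and the right side decreases in \<open>x\<close>, so this can only hold before they meet at \<open>t\<close>.
  The lemma places \<open>r_minus\<close> and \<open>r_plus + r_minus\<close> relative to \<open>rt_minus\<close>.
\<close>

lemma less_negative_root:
  fixes s c \<gamma> t x :: real
  assumes "s > 0" and "\<gamma> > 0" and "t < 0" and "x < 0"
    and root: "s / 2 * t\<^sup>2 + c * t = \<gamma>" and pos: "s / 2 * x\<^sup>2 + c * x > \<gamma>"
  shows "x < t"
proof (rule ccontr)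
  assume "\<not> x < t"
  then have "t \<le> x" by simp
  have "s / 2 * t + c = \<gamma> / t"
    using root assms(3) by (simp add: field_simps power2_eq_square)
  moreover have "s / 2 * x + c < \<gamma> / x"
    using pos assms(4) by (simp add: field_simps power2_eq_square)
  moreover have "\<gamma> / x \<le> \<gamma> / t"
    using \<open>t \<le> x\<close> assms(2-4) by (intro divide_left_mono) (auto intro: mult_neg_neg)
  moreover have "s / 2 * t \<le> s / 2 * x"
    using \<open>t \<le> x\<close> assms(1) by simp
  ultimately show False by linarith
qed

section \<open>The pasted solution\<close>

text \<open>
  The relations between the constants on which the verification rests.  Given \<open>slope_fit\<close>, the
  condition \<open>curvature_fit\<close> is the equation that the logarithm in \<open>x1\<close> solves.
\<close>

locale smooth_fit =
  fixes s b \<gamma> M p m t z K :: real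
  assumes \<gamma>_pos: "\<gamma> > 0"
    and p_pos: "p > 0" and m_neg: "m < 0" and t_neg: "t < 0"
    and root_p: "s / 2 * p\<^sup>2 + b * p = \<gamma>" and root_m: "s / 2 * m\<^sup>2 + b * m = \<gamma>"
    and root_t: "s / 2 * t\<^sup>2 + (b - M) * t = \<gamma>"
    and t_ge: "- 2 * b \<le> s * t"
    and z_pos: "z > 0" and K_pos: "K > 0"
    and slope_fit: "K * (p * exp (p * z) - m * exp (m * z)) = 1"
    and curvature_fit: "K * (p\<^sup>2 * exp (p * z) - m\<^sup>2 * exp (m * z)) = t"
begin

definition v :: "real \<Rightarrow> real" where
  "v x = (if x < z then K * (exp (p * x) - exp (m * x)) else M / \<gamma> + 1 / t * exp (t * (x - z)))"

definition v' :: "real \<Rightarrow> real" where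
  "v' x = (if x < z then K * (p * exp (p * x) - m * exp (m * x)) else exp (t * (x - z)))"

definition v'' :: "real \<Rightarrow> real" where
  "v'' x = (if x < z then K * (p\<^sup>2 * exp (p * x) - m\<^sup>2 * exp (m * x)) else t * exp (t * (x - z)))"

lemma ode_left:
  "s / 2 * (K * (p\<^sup>2 * exp (p * x) - m\<^sup>2 * exp (m * x))) + b * (K * (p * exp (p * x) - m * exp (m * x)))
     = \<gamma> * (K * (exp (p * x) - exp (m * x)))"
proof -
  have "s / 2 * (K * (p\<^sup>2 * exp (p * x) - m\<^sup>2 * exp (m * x)))
          + b * (K * (p * exp (p * x) - m * exp (m * x)))
      = K * ((s / 2 * p\<^sup>2 + b * p) * exp (p * x) - (s / 2 * m\<^sup>2 + b * m) * exp (m * x))"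
    by (simp add: field_simps)
  also have "\<dots> = \<gamma> * (K * (exp (p * x) - exp (m * x)))"
    unfolding root_p root_m by (simp add: algebra_simps)
  finally show ?thesis .
qed

lemma root_t_divided: "s / 2 * t + b = M + \<gamma> / t"
proof -
  have "(s / 2 * t + b) * t = (M + \<gamma> / t) * t"
    using root_t t_neg by (simp add: power2_eq_square algebra_simps)
  then show ?thesis using t_neg by simp
qed

text \<open>
  At \<open>z\<close> the left equation reads \<open>s t / 2 + b = \<gamma> v\<close>, and the equation for \<open>t\<close> evaluates its left
  side, so continuity of \<open>v\<close> is a consequence of the first two derivatives matching.
\<close>

lemma value_fit: "K * (exp (p * z) - exp (m * z)) = M / \<gamma> + 1 / t"
proof -
  have "\<gamma> * (K * (exp (p * z) - exp (m * z))) = s / 2 * t + b"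
    using ode_left[of z] by (simp add: slope_fit curvature_fit)
  also have "\<dots> = \<gamma> * (M / \<gamma> + 1 / t)"
    using \<gamma>_pos unfolding root_t_divided by (simp add: algebra_simps)
  finally show ?thesis using \<gamma>_pos by simp
qed

lemma has_derivative_v: "(v has_real_derivative v' x) (at x)"
proof -
  have "((\<lambda>x. if x < z then K * (exp (p * x) - exp (m * x)) else M / \<gamma> + 1 / t * exp (t * (x - z)))
      has_real_derivative
      (if x < z then K * (p * exp (p * x) - m * exp (m * x)) else exp (t * (x - z)))) (at x)"
    using t_neg
    by (intro has_real_derivative_glue)
       (auto intro!: derivative_eq_intros simp: value_fit slope_fit)
  then show ?thesis by (simp add: v_def[abs_def] v'_def)
qed

lemma has_derivative_v': "(v' has_real_derivative v'' x) (at x)"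
proof -
  have "((\<lambda>x. if x < z then K * (p * exp (p * x) - m * exp (m * x)) else exp (t * (x - z)))
      has_real_derivative
      (if x < z then K * (p\<^sup>2 * exp (p * x) - m\<^sup>2 * exp (m * x)) else t * exp (t * (x - z)))) (at x)"
    by (intro has_real_derivative_glue)
       (auto intro!: derivative_eq_intros simp: curvature_fit[unfolded power2_eq_square] slope_fit power2_eq_square)
  then show ?thesis by (simp add: v'_def[abs_def] v''_def)
qed

lemma continuous_v'': "continuous_on {0..} v''"
proof -
  have "continuous_on ({..z} \<union> {z..}) (\<lambda>x. if x \<le> z
      then K * (p\<^sup>2 * exp (p * x) - m\<^sup>2 * exp (m * x)) else t * exp (t * (x - z)))"
    by (intro continuous_on_If continuous_intros) (auto simp: curvature_fit)
  moreover have "(\<lambda>x. if x \<le> z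
      then K * (p\<^sup>2 * exp (p * x) - m\<^sup>2 * exp (m * x)) else t * exp (t * (x - z))) = v''"
    by (auto simp: v''_def fun_eq_iff curvature_fit)
  ultimately have "continuous_on ({..z} \<union> {z..}) v''" by (simp only:)
  then show ?thesis by (rule continuous_on_subset) auto
qed

text \<open>
  On the left branch \<open>v''\<close> is increasing, because \<open>p > 0 > m\<close>, and it ends at the value \<open>t\<close>.
\<close>

lemma v''_neg: "v'' x < 0"
proof (cases "x < z")
  case True
  have "exp (p * x) \<le> exp (p * z)" and "exp (m * z) \<le> exp (m * x)"
    using True p_pos m_neg by (simp_all add: mult_left_mono_neg)
  then have "p\<^sup>2 * exp (p * x) - m\<^sup>2 * exp (m * x) \<le> p\<^sup>2 * exp (p * z) - m\<^sup>2 * exp (m * z)"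
    by (intro diff_mono mult_left_mono) auto
  then have "v'' x \<le> t"
    using True K_pos mult_left_mono[of _ _ K] by (subst curvature_fit[symmetric]) (simp add: v''_def)
  then show ?thesis using t_neg by simp
next
  case False
  then show ?thesis using t_neg by (simp add: v''_def mult_less_0_iff)
qed

lemma v'_pos: "v' x > 0"
proof -
  have "p * exp (p * x) > 0" and "m * exp (m * x) < 0"
    using p_pos m_neg by (simp_all add: mult_less_0_iff)
  then have "p * exp (p * x) - m * exp (m * x) > 0" by linarith
  then show ?thesis using K_pos by (simp add: v'_def)
qed

lemma v'_antimono: "x \<le> y \<Longrightarrow> v' y \<le> v' x"
  using has_derivative_v' v''_neg by (intro DERIV_nonpos_imp_nonincreasing[of x y v']) (auto intro: less_imp_le)

lemma v_mono: "x \<le> y \<Longrightarrow> v x \<le> v y"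
  using has_derivative_v v'_pos by (intro DERIV_nonneg_imp_nondecreasing[of x y v]) (auto intro: less_imp_le)

lemma v_0: "v 0 = 0"
  using z_pos by (simp add: v_def)

lemma v_nonneg: "x \<ge> 0 \<Longrightarrow> v x \<ge> 0"
  using v_mono[of 0 x] by (simp add: v_0)

lemma v_le: "v x \<le> M / \<gamma>"
proof -
  have "v x \<le> v (max x z)" by (intro v_mono) simp
  also have "\<dots> \<le> M / \<gamma>"
    using t_neg by (simp add: v_def divide_le_0_iff)
  finally show ?thesis .
qed

lemma concave_v: "concave_on {0..} v"
  using has_derivative_v has_derivative_v' v''_neg
  by (intro f''_le0_imp_concave[where f' = v' and f'' = v'']) (auto intro: less_imp_le)

text \<open>
  Since \<open>v'\<close> is decreasing with \<open>v' z = 1\<close>, the positive part vanishes to the left of \<open>z\<close> and is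
  \<open>1 - v'\<close> to the right of it.
\<close>

lemma ode: "s / 2 * v'' x + b * v' x - \<gamma> * v x + M * max (1 - v' x) 0 = 0"
proof (cases "x < z")
  case True
  have "v' z = 1" by (simp add: v'_def)
  then have "max (1 - v' x) 0 = 0"
    using v'_antimono[of x z] True by simp
  then show ?thesis
    using ode_left[of x] True by (simp add: v_def v'_def v''_def)
next
  case False
  have "v' x \<le> 1"
    using v'_antimono[of z x] False by (simp add: v'_def)
  then have "s / 2 * v'' x + b * v' x - \<gamma> * v x + M * max (1 - v' x) 0
      = (s / 2 * t + b - M - \<gamma> / t) * exp (t * (x - z))"
    using False \<gamma>_pos by (simp add: v_def v'_def v''_def algebra_simps)
  also have "s / 2 * t + b - M - \<gamma> / t = 0" using root_t_divided by linarith
  finally show ?thesis by simp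
qed

text \<open>
  This bounds the curvature ratio by \<open>- v'' / v' \<le> 2 b / s\<close>, which is what makes the largest
  admissible control optimal.
\<close>

lemma drift_dominates:
  assumes "x \<ge> 0"
  shows "0 \<le> s * v'' x + 2 * b * v' x"
proof (cases "x < z")
  case True
  have "s / 2 * v'' x + b * v' x = \<gamma> * v x"
    using ode_left[of x] True by (simp add: v_def v'_def v''_def)
  moreover have "\<gamma> * v x \<ge> 0" using v_nonneg[OF assms] \<gamma>_pos by simp
  ultimately show ?thesis by linarith
next
  case False
  have "0 \<le> (s * t + 2 * b) * exp (t * (x - z))"
    using t_ge by (intro mult_nonneg_nonneg) auto
  then show ?thesis using False by (simp add: v'_def v''_def algebra_simps)
qed

section \<open>The Hamilton-Jacobi-Bellman equation\<close>

lemma C2_v: "C2_on_with {0..} v v' v''"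
  unfolding C2_on_with_def
  using has_derivative_v has_derivative_v' continuous_v''
  by (auto intro: has_field_derivative_at_within)

lemma solves_HJB_v:
  assumes s_eq: "s = \<sigma>\<^sup>2 * \<beta>\<^sup>2" and b_eq: "b = \<beta> * \<mu> - \<delta>"
    and \<alpha>: "0 < \<alpha>" "\<alpha> \<le> \<beta>" and le: "\<beta> * \<mu> \<le> 2 * \<delta>"
  shows "solves_HJB \<mu> \<sigma> \<gamma> \<delta> M \<alpha> \<beta> v v' v''"
proof -
  have "is_max_over 0
      (\<lambda>a. 1 / 2 * \<sigma>\<^sup>2 * a\<^sup>2 * v'' x + (a * \<mu> - \<delta>) * v' x - \<gamma> * v x + M * max (1 - v' x) 0) {\<alpha>..\<beta>}"
    (is "is_max_over 0 ?H _") if x: "x \<ge> 0" for x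
  proof -
    have H_\<beta>: "?H \<beta> = 0"
      using ode[of x] by (simp add: s_eq b_eq)
    have marginal: "0 \<le> \<sigma>\<^sup>2 * \<beta> * v'' x + \<mu> * v' x"
    proof -
      have "0 \<le> s * v'' x + 2 * b * v' x" by (rule drift_dominates[OF x])
      also have "\<dots> \<le> s * v'' x + \<beta> * \<mu> * v' x"
        using le v'_pos[of x] by (intro add_left_mono mult_right_mono) (simp_all add: b_eq)
      also have "\<dots> = \<beta> * (\<sigma>\<^sup>2 * \<beta> * v'' x + \<mu> * v' x)"
        by (simp add: s_eq power2_eq_square algebra_simps)
      finally show ?thesis using \<alpha> by (simp add: zero_le_mult_iff)
    qed
    \<comment> \<open>By the quadratic form of the Hamiltonian, its increment from \<open>a\<close> to \<open>\<beta>\<close> is \<open>\<beta> - a\<close> times its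
      derivative at the midpoint; since \<open>v'' < 0\<close>, the latter is at least the derivative at \<open>\<beta>\<close>.\<close>
    have "?H a \<le> 0" if a: "a \<in> {\<alpha>..\<beta>}" for a
    proof -
      have "\<sigma>\<^sup>2 * \<beta> * v'' x \<le> \<sigma>\<^sup>2 * ((\<beta> + a) / 2) * v'' x"
        using a v''_neg[of x] by (intro mult_right_mono_neg mult_left_mono) auto
      then have "0 \<le> (\<beta> - a) * (\<sigma>\<^sup>2 * ((\<beta> + a) / 2) * v'' x + \<mu> * v' x)"
        using a marginal by (intro mult_nonneg_nonneg) auto
      also have "\<dots> = ?H \<beta> - ?H a"
        by (simp add: power2_eq_square field_simps)
      finally show ?thesis using H_\<beta> by linarith
    qed
    moreover have "0 \<in> ?H ` {\<alpha>..\<beta>}"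
      using \<alpha> H_\<beta> by (intro image_eqI[where x = \<beta>]) auto
    ultimately show ?thesis by (simp add: is_max_over_def)
  qed
  then show ?thesis by (simp add: solves_HJB_def v_0)
qed

end

section \<open>The constants\<close>

text \<open>
  The equation in the conclusion is \<open>f'' = t f'\<close> at \<open>z\<close> for \<open>f x = exp (p x) - exp (m x)\<close>.  It reads
  \<open>exp ((p - m) z) = m (m - t) / (p (p - t))\<close>, so that \<open>z\<close> is positive when the quotient exceeds \<open>1\<close>;
  the numerator minus the denominator is \<open>(p - m) (t - (p + m))\<close>.
\<close>

lemma switching_point:
  fixes p m t :: real
  assumes "p > 0" and "m < 0" and "m < t" and "t < 0" and "p + m < t"
  defines "z \<equiv> 1 / (p - m) * ln ((m * (m - t)) / (p * (p - t)))"
  shows "z > 0" and "p * (p - t) * exp (p * z) = m * (m - t) * exp (m * z)"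
proof -
  have den: "p * (p - t) > 0" and num: "m * (m - t) > 0"
    using assms by (simp_all add: mult_neg_neg)
  have "m * (m - t) - p * (p - t) = (p - m) * (t - (p + m))"
    by (simp add: algebra_simps)
  also have "\<dots> > 0" using assms by simp
  finally have gt: "(m * (m - t)) / (p * (p - t)) > 1"
    using den by simp
  then show "z > 0"
    unfolding z_def using assms(1,2) by (intro mult_pos_pos ln_gt_zero) simp_all
  have "exp (p * z) = exp (m * z) * exp ((p - m) * z)"
    by (simp add: algebra_simps flip: exp_add)
  also have "exp ((p - m) * z) = (m * (m - t)) / (p * (p - t))"
    using gt assms(1,2) by (simp add: z_def)
  finally have "p * (p - t) * exp (p * z)
      = exp (m * z) * (p * (p - t) * ((m * (m - t)) / (p * (p - t))))"
    by (simp only: mult.left_commute)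
  also have "p * (p - t) * ((m * (m - t)) / (p * (p - t))) = m * (m - t)"
    using den by (metis less_irrefl nonzero_mult_div_cancel_left times_divide_eq_right)
  finally show "p * (p - t) * exp (p * z) = m * (m - t) * exp (m * z)"
    by (simp only: mult.commute)
qed

lemma K_const_normalizes_slope:
  fixes \<mu> \<sigma> \<gamma> \<delta> M \<beta> :: real
  defines "p \<equiv> r_plus \<mu> \<sigma> \<gamma> \<delta> \<beta>" and "m \<equiv> r_minus \<mu> \<sigma> \<gamma> \<delta> \<beta>" and "z \<equiv> x1 \<mu> \<sigma> \<gamma> \<delta> M \<beta>"
  assumes "p > 0" and "m < 0"
  shows "K_const \<mu> \<sigma> \<gamma> \<delta> M \<beta> > 0"
    and "K_const \<mu> \<sigma> \<gamma> \<delta> M \<beta> * (p * exp (p * z) - m * exp (m * z)) = 1"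
proof -
  have "p * exp (p * z) > 0" and "m * exp (m * z) < 0"
    using assms(4,5) by (simp_all add: mult_less_0_iff)
  then have pos: "p * exp (p * z) - m * exp (m * z) > 0" by linarith
  have "K_const \<mu> \<sigma> \<gamma> \<delta> M \<beta> = (THE K. K * (p * exp (p * z) - m * exp (m * z)) = 1)"
    by (simp add: K_const_def Let_def p_def m_def z_def)
  also have "\<dots> = 1 / (p * exp (p * z) - m * exp (m * z))"
    using pos by (intro the_equality) (auto simp: field_simps)
  finally show "K_const \<mu> \<sigma> \<gamma> \<delta> M \<beta> > 0"
    and "K_const \<mu> \<sigma> \<gamma> \<delta> M \<beta> * (p * exp (p * z) - m * exp (m * z)) = 1"
    using pos by simp_all
qed

theorem theorem3p18:
  fixes \<mu> \<sigma> \<gamma> \<delta> M \<alpha> \<beta> :: real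
  assumes "\<mu> > 0" and "\<sigma> > 0" and "\<gamma> > 0" and "\<delta> \<ge> 0" and "M > 0"
    and "0 < \<alpha>" and "\<alpha> < \<beta>"
    and "\<delta> / \<mu> < \<beta>" and "\<beta> \<le> 2 * \<delta> / \<mu>"
    and "M > M0 \<mu> \<sigma> \<gamma> \<delta> \<beta>"
  shows "concave_on {0..} (V \<mu> \<sigma> \<gamma> \<delta> M \<beta>) \<and>
    (\<exists>V' V''. C2_on_with {0..} (V \<mu> \<sigma> \<gamma> \<delta> M \<beta>) V' V'' \<and>
       solves_HJB \<mu> \<sigma> \<gamma> \<delta> M \<alpha> \<beta> (V \<mu> \<sigma> \<gamma> \<delta> M \<beta>) V' V'') \<and>
    (\<forall>x>0. 0 \<le> V \<mu> \<sigma> \<gamma> \<delta> M \<beta> x \<and> V \<mu> \<sigma> \<gamma> \<delta> M \<beta> x \<le> M / \<gamma>)"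
proof -
  define s where "s = \<sigma>\<^sup>2 * \<beta>\<^sup>2"
  define b where "b = \<beta> * \<mu> - \<delta>"
  define p where "p = r_plus \<mu> \<sigma> \<gamma> \<delta> \<beta>"
  define m where "m = r_minus \<mu> \<sigma> \<gamma> \<delta> \<beta>"
  define t where "t = rt_minus \<mu> \<sigma> \<gamma> \<delta> M \<beta>"
  define z where "z = x1 \<mu> \<sigma> \<gamma> \<delta> M \<beta>"
  define K where "K = K_const \<mu> \<sigma> \<gamma> \<delta> M \<beta>"
  have s: "s > 0" using assms by (simp add: s_def)
  have b: "b > 0" using assms by (simp add: b_def field_simps)
  have le: "\<beta> * \<mu> \<le> 2 * \<delta>" using assms by (simp add: field_simps)
  have p_eq: "p = (- b + sqrt (b\<^sup>2 + 2 * \<gamma> * s)) / s"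
    and m_eq: "m = (- b - sqrt (b\<^sup>2 + 2 * \<gamma> * s)) / s"
    and t_eq: "t = (- (b - M) - sqrt ((b - M)\<^sup>2 + 2 * \<gamma> * s)) / s"
    by (simp_all add: p_def m_def t_def b_def s_def r_plus_def r_minus_def rt_minus_def mult.assoc)
  note pm = quadratic_roots[OF s \<open>\<gamma> > 0\<close>, of b, folded p_eq m_eq]
  note t_root = quadratic_roots(2,5)[OF s \<open>\<gamma> > 0\<close>, of "b - M", folded t_eq]
  \<comment> \<open>The polynomial that vanishes at \<open>t\<close> has the value \<open>- M m > 0\<close> at \<open>m\<close>.\<close>
  have "m < t"
  proof (rule less_negative_root[OF s \<open>\<gamma> > 0\<close> t_root(1) pm(2) t_root(2)])
    have "M * m < 0" using \<open>M > 0\<close> pm(2) by (simp add: mult_pos_neg)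
    then show "\<gamma> < s / 2 * m\<^sup>2 + (b - M) * m"
      using pm(5) by (simp add: algebra_simps)
  qed
  have sum: "p + m = - 2 * b / s"
    using pm(3) s by (simp add: field_simps)
  have "p + m < t"
  proof (rule less_negative_root[OF s \<open>\<gamma> > 0\<close> t_root(1) _ t_root(2)])
    show "p + m < 0" using b s by (simp add: sum)
    have "s * \<gamma> < M * (2 * b)"
      using assms(10) b by (simp add: M0_def s_def b_def field_simps)
    then have "\<gamma> < 2 * b * M / s" using s by (simp add: field_simps)
    also have "\<dots> = s / 2 * (p + m)\<^sup>2 + (b - M) * (p + m)"
      unfolding sum using s by (simp add: field_simps power2_eq_square)
    finally show "\<gamma> < s / 2 * (p + m)\<^sup>2 + (b - M) * (p + m)" .
  qed
  have z_eq: "z = 1 / (p - m) * ln ((m * (m - t)) / (p * (p - t)))"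
    by (simp add: z_def x1_def p_def m_def t_def Let_def)
  note z = switching_point[OF pm(1,2) \<open>m < t\<close> t_root(1) \<open>p + m < t\<close>, folded z_eq]
  have K: "K > 0" "K * (p * exp (p * z) - m * exp (m * z)) = 1"
    using K_const_normalizes_slope pm(1,2) unfolding K_def p_def m_def z_def by blast+
  have "K * (p\<^sup>2 * exp (p * z) - m\<^sup>2 * exp (m * z))
      = t * (K * (p * exp (p * z) - m * exp (m * z)))"
  proof -
    have "p\<^sup>2 * exp (p * z) - m\<^sup>2 * exp (m * z) = t * (p * exp (p * z) - m * exp (m * z))"
      using z(2) by (simp add: algebra_simps power2_eq_square)
    then show ?thesis by simp
  qed
  then have curvature: "K * (p\<^sup>2 * exp (p * z) - m\<^sup>2 * exp (m * z)) = t"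
    by (simp add: K(2))
  have t_ge: "- 2 * b \<le> s * t"
    using mult_strict_left_mono[OF \<open>p + m < t\<close> s] pm(3) by linarith
  interpret smooth_fit s b \<gamma> M p m t z K
    using assms pm t_root t_ge z(1) K curvature by unfold_locales auto
  have V_eq: "V \<mu> \<sigma> \<gamma> \<delta> M \<beta> = v"
    by (simp add: fun_eq_iff V_def v_def Let_def flip: p_def m_def t_def z_def K_def)
  have "solves_HJB \<mu> \<sigma> \<gamma> \<delta> M \<alpha> \<beta> v v' v''"
    using assms le by (intro solves_HJB_v) (simp_all add: s_def b_def)
  then show ?thesis
    unfolding V_eq using concave_v C2_v v_nonneg v_le by (auto intro: less_imp_le)
qed

end
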